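(* For every integer $k\in\mathbb{Z}$, every integer $r\geq 0$ and every integer $n\geq 0$, $$B_{n}^{(k)}(x)=\sum_{m=0}^{n}\left\{\binom{n}{m}\sum_{l=0}^{n-m}\frac{r!\,(n-m)_{l}}{(l+r)!}S_{2}(l+r,r)B_{n-l-m}^{(k)}\right\}\mathbb{B}_{m}^{(r)}(x).$$
   Context: For $k\in\mathbb{Z}$, the polylogarithm is $Li_k(x)=\sum_{m=1}^{\infty}\frac{x^m}{m^k}$. The poly-Bernoulli polynomials $B_n^{(k)}(x)$ are defined by the generating function (an identity of formal power series in $t$) $$\frac{Li_{k}(1-e^{-t})}{1-e^{-t}}e^{xt}=\sum_{n=0}^{\infty}B_{n}^{(k)}(x)\frac{t^{n}}{n!},$$ and $B_n^{(k)}=B_n^{(k)}(0)$ are the poly-Bernoulli numbers. The Bernoulli polynomials of order $r$ are defined by $\left(\frac{t}{e^t-1}\right)^r e^{xt}=\sum_{n=0}^\infty \mathbb{B}_n^{(r)}(x)\frac{t^n}{n!}$. $S_2(l,m)$ denotes the Stirling numbers of the second kind, defined by $(e^t-1)^m=m!\sum_{l=m}^\infty S_2(l,m)\frac{t^l}{l!}$. $(a)_l=a(a-1)\cdots(a-l+1)$ is the falling factorial, with $(a)_0=1$. *)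

theory Defs
  imports
    "HOL-Computational_Algebra.Formal_Power_Series"
    "HOL-Combinatorics.Stirling"
begin

text \<open>
  All generating functions are formal power series in \<open>t\<close> (that is, \<^const>\<open>fps_X\<close>) over an
  arbitrary field of characteristic 0, and \<open>x\<close> ranges over that field. As the field is infinite,
  an identity for all \<open>x\<close> is the same as an identity of polynomials in \<open>x\<close>.
\<close>

definition polylog :: "int \<Rightarrow> 'a::field_char_0 fps" where
  "polylog k = Abs_fps (\<lambda>m. if m = 0 then 0 else 1 / of_nat m powi k)"

text \<open>
  The denominators \<open>1 - e^(-t)\<close> and \<open>e^t - 1\<close> below have vanishing constant term, but division of
  formal power series over a field cancels common powers of \<open>t\<close>; the quotients are therefore the
  exact ones, as confirmed by the lemmas \<open>polylog_quotient\<close> and \<open>bernoulli_quotient\<close>.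
\<close>

definition poly_bernoulli :: "nat \<Rightarrow> int \<Rightarrow> 'a::field_char_0 \<Rightarrow> 'a" where
  "poly_bernoulli n k x =
     fact n * fps_nth ((polylog k oo (1 - fps_exp (-1))) / (1 - fps_exp (-1)) * fps_exp x) n"

definition poly_bernoulli_num :: "nat \<Rightarrow> int \<Rightarrow> 'a::field_char_0" where
  "poly_bernoulli_num n k = poly_bernoulli n k 0"

definition bernoulli_order :: "nat \<Rightarrow> nat \<Rightarrow> 'a::field_char_0 \<Rightarrow> 'a" where
  "bernoulli_order n r x = fact n * fps_nth ((fps_X / (fps_exp 1 - 1)) ^ r * fps_exp x) n"

definition falling_fact :: "'a::comm_ring_1 \<Rightarrow> nat \<Rightarrow> 'a" where
  "falling_fact a l = (\<Prod>i<l. a - of_nat i)"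

lemma subdegree_one_minus_exp: "subdegree (1 - fps_exp (-1) :: 'a::field_char_0 fps) = 1"
  by (rule subdegreeI) auto

lemma subdegree_exp_minus_one: "subdegree (fps_exp 1 - 1 :: 'a::field_char_0 fps) = 1"
  by (rule subdegreeI) auto

lemma polylog_quotient:
  "(polylog k oo (1 - fps_exp (-1))) / (1 - fps_exp (-1)) * (1 - fps_exp (-1)) =
   (polylog k oo (1 - fps_exp (-1)) :: 'a::field_char_0 fps)"
proof (cases "(polylog k oo (1 - fps_exp (-1)) :: 'a fps) = 0")
  case False
  moreover have "fps_nth (polylog k oo (1 - fps_exp (-1)) :: 'a fps) 0 = 0"
    by (simp add: polylog_def)
  ultimately have "subdegree (polylog k oo (1 - fps_exp (-1)) :: 'a fps) \<ge> 1"
    by (intro subdegree_geI) auto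
  moreover have "(1 - fps_exp (-1) :: 'a fps) \<noteq> 0"
    using subdegree_one_minus_exp by (metis subdegree_0 zero_neq_one)
  ultimately have "(1 - fps_exp (-1) :: 'a fps) dvd (polylog k oo (1 - fps_exp (-1)))"
    using False by (simp add: fps_dvd_iff subdegree_one_minus_exp)
  then show ?thesis by simp
qed simp

lemma bernoulli_quotient:
  "fps_X / (fps_exp 1 - 1) * (fps_exp 1 - 1) = (fps_X :: 'a::field_char_0 fps)"
proof -
  have "(fps_exp 1 - 1 :: 'a fps) \<noteq> 0"
    using subdegree_exp_minus_one by (metis subdegree_0 zero_neq_one)
  then have "(fps_exp 1 - 1 :: 'a fps) dvd fps_X"
    using subdegree_exp_minus_one[where 'a = 'a] by (subst fps_dvd_iff) simp_all
  then show ?thesis by simp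
qed

lemma poly_bernoulli_gf:
  "(polylog k oo (1 - fps_exp (-1))) / (1 - fps_exp (-1)) * fps_exp x =
   Abs_fps (\<lambda>n. poly_bernoulli n k x / fact n)"
  by (rule fps_ext) (simp add: poly_bernoulli_def)

lemma bernoulli_order_gf:
  "(fps_X / (fps_exp 1 - 1)) ^ r * fps_exp x = Abs_fps (\<lambda>n. bernoulli_order n r x / fact n)"
  by (rule fps_ext) (simp add: bernoulli_order_def)

text \<open>
  The library defines \<^const>\<open>Stirling\<close> by its recurrence; the following lemma is the
  generating function identity that characterises the numbers \<open>S\<^sub>2(l, m)\<close>.
\<close>

lemma Stirling_gf:
  "(fps_exp 1 - 1) ^ m =
   fps_const (fact m) * Abs_fps (\<lambda>l. of_nat (Stirling l m) / fact l :: 'a::field_char_0)"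
proof (rule fps_ext)
  fix l
  let ?E = "fps_exp 1 - 1 :: 'a fps"
  have rec: "of_nat (Suc l) * fps_nth (?E ^ Suc m) (Suc l) =
     of_nat (Suc m) * (fps_nth (?E ^ m) l + fps_nth (?E ^ Suc m) l)" for l m
  proof -
    have "fps_deriv (?E ^ Suc m) = of_nat (Suc m) * (?E ^ m + ?E ^ Suc m)"
    proof -
      have "fps_deriv (?E ^ Suc m) = of_nat (Suc m) * (fps_exp 1 * ?E ^ m)"
        by (simp add: fps_deriv_power' mult.assoc del: power_Suc of_nat_Suc)
      also have "fps_exp 1 * ?E ^ m = ?E ^ m + ?E ^ Suc m"
        by (simp add: left_diff_distrib)
      finally show ?thesis .
    qed
    then have "fps_nth (fps_deriv (?E ^ Suc m)) l =
        fps_nth (fps_const (of_nat (Suc m)) * (?E ^ m + ?E ^ Suc m)) l"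
      by (simp only: fps_of_nat)
    then show ?thesis
      by (simp only: fps_deriv_nth fps_mult_left_const_nth fps_add_nth Suc_eq_plus1)
  qed
  have "fps_nth (?E ^ m) l = fact m * of_nat (Stirling l m) / fact l"
  proof (induction l arbitrary: m)
    case 0
    show ?case by (cases m) auto
  next
    case (Suc l)
    show ?case
    proof (cases m)
      case 0
      then show ?thesis by simp
    next
      case (Suc m')
      have "of_nat (Suc l) * fps_nth (?E ^ m) (Suc l) =
          of_nat (Suc m') * (fact m' * of_nat (Stirling l m') / fact l +
            fact (Suc m') * of_nat (Stirling l (Suc m')) / fact l)"
        unfolding Suc rec Suc.IH ..
      also have "\<dots> = fact m * of_nat (Stirling (Suc l) m) / fact l"
        by (simp add: Suc field_simps)
      also have "\<dots> = of_nat (Suc l) * (fact m * of_nat (Stirling (Suc l) m) / fact (Suc l))"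
        by (simp del: of_nat_Suc Stirling.simps)
      finally show ?thesis
        by (simp only: mult_cancel_left of_nat_eq_0_iff) simp
    qed
  qed
  then show "fps_nth (?E ^ m) l =
      fps_nth (fps_const (fact m) * Abs_fps (\<lambda>l. of_nat (Stirling l m) / fact l)) l"
    by simp
qed

end

theory Submission
  imports Defs
begin

text \<open>
  The series \<open>G(t) = ((e\<^sup>t - 1) / t)\<^sup>r\<close> has the coefficients \<open>r! S\<^sub>2(l + r, r) / (l + r)!\<close>, and it
  is inverse to the factor \<open>(t / (e\<^sup>t - 1))\<^sup>r\<close> in the generating function of the Bernoulli
  polynomials of order \<open>r\<close>. So the generating function of the poly-Bernoulli polynomials is the
  product of that of the poly-Bernoulli numbers, of \<open>G\<close>, and of that of the Bernoulli polynomials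
  of order \<open>r\<close>. The theorem compares coefficients.
\<close>

lemma falling_fact_of_nat:
  assumes "l \<le> N"
  shows "falling_fact (of_nat N) l = (fact N / fact (N - l) :: 'a::field_char_0)"
  using assms
proof (induction l)
  case 0
  show ?case by (simp add: falling_fact_def)
next
  case (Suc l)
  have "fact (N - l) = (of_nat (N - l) * fact (N - Suc l) :: 'a)"
    using Suc.prems fact_reduce[of "N - l", where 'a = 'a] by simp
  moreover have "of_nat (N - l) = (of_nat N - of_nat l :: 'a)"
    using Suc.prems by (simp add: of_nat_diff)
  moreover have "of_nat (N - l) \<noteq> (0 :: 'a)"
    using Suc.prems by simp
  moreover have "falling_fact (of_nat N) (Suc l) =
      falling_fact (of_nat N) l * (of_nat N - of_nat l :: 'a)"
    by (simp add: falling_fact_def)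
  ultimately show ?case
    using Suc by simp
qed

definition stirling_fps :: "nat \<Rightarrow> 'a::field_char_0 fps" where
  "stirling_fps r = Abs_fps (\<lambda>l. fact r * of_nat (Stirling (l + r) r) / fact (l + r))"

text \<open>Multiplication by \<open>fps_X ^ r\<close> undoes the index shift by \<open>r\<close>;
  no terms are lost, since \<open>Stirling j r = 0\<close> for \<open>j < r\<close>.\<close>

lemma stirling_fps_mult_X_power: "stirling_fps r * fps_X ^ r = (fps_exp 1 - 1) ^ r"
  unfolding Stirling_gf
  by (rule fps_ext) (auto simp: stirling_fps_def fps_X_power_mult_right_nth)

lemma stirling_fps_inverse:
  "stirling_fps r * (fps_X / (fps_exp 1 - 1)) ^ r = (1 :: 'a::field_char_0 fps)"
proof -
  \<comment> \<open>The extra factor \<open>fps_X ^ r\<close> completes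
    \<open>stirling_fps r\<close> to \<open>(fps_exp 1 - 1) ^ r\<close>; being nonzero, it can be
    cancelled afterwards.\<close>
  have "stirling_fps r * (fps_X / (fps_exp 1 - 1)) ^ r * fps_X ^ r =
      (fps_X / (fps_exp 1 - 1) * (fps_exp 1 - 1)) ^ r"
    by (simp only: power_mult_distrib flip: stirling_fps_mult_X_power) (simp only: ac_simps)
  then have "stirling_fps r * (fps_X / (fps_exp 1 - 1)) ^ r * fps_X ^ r = 1 * (fps_X ^ r :: 'a fps)"
    by (simp only: bernoulli_quotient mult_1)
  then show ?thesis
    by (subst (asm) mult_right_cancel) simp_all
qed

theorem theorem4:
  fixes k :: int and r n :: nat and x :: "'a::field_char_0"
  shows "poly_bernoulli n k x =
    (\<Sum>m=0..n.
       (of_nat (n choose m) *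
         (\<Sum>l=0..n-m. fact r * falling_fact (of_nat (n - m)) l / fact (l + r)
            * of_nat (Stirling (l + r) r) * poly_bernoulli_num (n - l - m) k))
       * bernoulli_order m r x)"
proof -
  define A where "A = (polylog k oo (1 - fps_exp (-1))) / (1 - fps_exp (-1) :: 'a fps)"
  define B where "B = (fps_X / (fps_exp 1 - 1)) ^ r * fps_exp x"
  have A_nth: "fps_nth A j = poly_bernoulli_num j k / fact j" for j
    by (simp add: A_def poly_bernoulli_num_def poly_bernoulli_def)
  have B_nth: "fps_nth B j = bernoulli_order j r x / fact j" for j
    by (simp add: B_def bernoulli_order_def)
  have "B * (stirling_fps r * A) =
      A * fps_exp x * (stirling_fps r * (fps_X / (fps_exp 1 - 1)) ^ r)"
    unfolding B_def by (simp only: ac_simps)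
  then have "B * (stirling_fps r * A) = A * fps_exp x"
    by (simp only: stirling_fps_inverse mult_1_right)
  then have "poly_bernoulli n k x = fact n * fps_nth (B * (stirling_fps r * A)) n"
    by (simp only: poly_bernoulli_def A_def)
  \<comment> \<open>Here n!/m! is split as the binomial coefficient times (n - m)!.\<close>
  also have "\<dots> = (\<Sum>m=0..n. (of_nat (n choose m) *
      (fact (n - m) * fps_nth (stirling_fps r * A) (n - m))) * bernoulli_order m r x)"
    unfolding fps_mult_nth[of B] sum_distrib_left
    by (rule sum.cong) (simp_all add: B_nth binomial_fact)
  also have "\<dots> = (\<Sum>m=0..n. (of_nat (n choose m) *
      (\<Sum>l=0..n-m. fact r * falling_fact (of_nat (n - m)) l / fact (l + r)
         * of_nat (Stirling (l + r) r) * poly_bernoulli_num (n - l - m) k))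
      * bernoulli_order m r x)"
  proof -
    \<comment> \<open>The quotient N!/(N - l)!, with (N - l)! from \<open>A_nth\<close>, is the
      falling factorial, as l \<le> N.\<close>
    have "fact N * fps_nth (stirling_fps r * A) N =
        (\<Sum>l=0..N. fact r * falling_fact (of_nat N) l / fact (l + r)
           * of_nat (Stirling (l + r) r) * poly_bernoulli_num (N - l) k)" for N
      unfolding fps_mult_nth sum_distrib_left
      by (rule sum.cong)
        (simp_all add: A_nth stirling_fps_def falling_fact_of_nat mult_ac)
    \<comment> \<open>With N = n - m, the index n - m - l has to be matched with n - l - m.\<close>
    then show ?thesis
      by (simp add: add.commute)
  qed
  finally show ?thesis .
qed

end
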